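(* Let $ABC$ be a triangle in the Euclidean plane with circumcircle $\Sigma$ and orthocentre $H$, and let $J$ be a point of $\Sigma$ distinct from $A,B,C$. Let $Q$ be any point on the perpendicular bisector of $JH$, and let $S$ be the circle with centre $Q$ passing through $J$ and $H$. Let $X, Y, Z$ be the second intersections (other than $H$) with $S$ of the altitudes of $ABC$ through $A$, $B$, $C$ respectively. Assume that each of the triples $A,J,X$; $B,J,Y$; $C,J,Z$ consists of three distinct non-collinear points, so that the circles $AJX$, $BJY$, $CJZ$ are defined. Let $L$ be the second intersection (other than $J$) of circles $BJY$ and $CJZ$, let $M$ be the second intersection of circles $CJZ$ and $AJX$, and let $N$ be the second intersection of circles $AJX$ and $BJY$. Then $L$ lies on the line $BC$, $M$ lies on the line $CA$, and $N$ lies on the line $AB$.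
   Context: The altitude through $A$ is the line through $A$ perpendicular to $BC$, and similarly for $B$ and $C$. Each altitude passes through $H$, which lies on $S$; if an altitude is tangent to $S$ at $H$, the corresponding second intersection is taken to be $H$ itself. Similarly, if two of the circles $AJX$, $BJY$, $CJZ$ were tangent at $J$, their second intersection would be taken to be $J$. *)

theory Defs
  imports "HOL-Analysis.Analysis"
begin

type_synonym point = "real ^ 2"

text \<open>For non-collinear points there is exactly one such circle, which is therefore named
  by a variable together with this predicate.\<close>

definition circle_through :: "point set \<Rightarrow> point \<Rightarrow> point \<Rightarrow> point \<Rightarrow> bool" where
  "circle_through K A B C \<longleftrightarrow>
     (\<exists>c r. 0 < r \<and> K = sphere c r) \<and> A \<in> K \<and> B \<in> K \<and> C \<in> K"

definition altitude :: "point \<Rightarrow> point \<Rightarrow> point \<Rightarrow> point set" where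
  "altitude A B C = {P. (P - A) \<bullet> (C - B) = 0}"

definition orthocentre :: "point \<Rightarrow> point \<Rightarrow> point \<Rightarrow> point \<Rightarrow> bool" where
  "orthocentre H A B C \<longleftrightarrow>
     H \<in> altitude A B C \<and> H \<in> altitude B C A \<and> H \<in> altitude C A B"

definition perp_bisector :: "point \<Rightarrow> point \<Rightarrow> point set" where
  "perp_bisector A B = {P. (P - midpoint A B) \<bullet> (B - A) = 0}"

text \<open>\<open>T\<close> is the second intersection, besides \<open>P\<close>, of the curves \<open>U\<close> and \<open>V\<close> (a line and a
  circle, or two circles). If the curves are tangent at \<open>P\<close>, so that \<open>U \<inter> V = {P}\<close>, this
  forces \<open>T = P\<close>; otherwise \<open>T \<noteq> P\<close> is the other common point. It is never satisfied by
  two coinciding circles.\<close>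

definition second_intersection :: "point \<Rightarrow> point set \<Rightarrow> point set \<Rightarrow> point \<Rightarrow> bool" where
  "second_intersection P U V T \<longleftrightarrow> U \<inter> V = {P, T}"

end

theory Submission imports Defs begin

text \<open>
  The proof is an angle chase with directed angles in which the angles are replaced by
  their cotangents. Fix \<open>J\<close>. For a point \<open>A \<noteq> J\<close> the circles through \<open>J\<close> and \<open>A\<close> are exactly the
  loci of points seeing the chord \<open>JA\<close> under a fixed directed angle, so each of them is
  determined by one real number \<open>k\<close>, the cotangent of that angle.

  Since \<open>X\<close> lies on \<open>S\<close>, the line \<open>JX\<close> meets the altitude \<open>XH\<close> under the angle \<open>k\<close> that belongs
  to \<open>S\<close> and its chord \<open>JH\<close>. The altitude is also the line \<open>XA\<close>, so \<open>X\<close> sees the chord \<open>JA\<close> under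
  this same angle, and circle \<open>AJX\<close> has the parameter \<open>k\<close> as well. Thus all three circles share
  one \<open>k\<close>. If \<open>P\<close> is the point of the line \<open>BC\<close> for which \<open>JP\<close> meets \<open>BC\<close> under the angle \<open>k\<close>, then
  \<open>P\<close> sees both \<open>JB\<close> and \<open>JC\<close> under that angle, hence lies on both circles \<open>BJY\<close> and \<open>CJZ\<close>. Because
  \<open>J\<close> is on the circumcircle and is no vertex, it is not on \<open>BC\<close>; so \<open>P \<noteq> J\<close>, and \<open>P\<close> is the second
  intersection \<open>L\<close>. The points \<open>M\<close> and \<open>N\<close> are handled in the same way.

  The argument needs \<open>J \<noteq> H\<close>, as otherwise \<open>JH\<close> is not a chord. This holds because an
  orthocentre that lies on the circumcircle is a vertex (of a right angle).
\<close>

section \<open>Quarter turns of the plane\<close>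

definition rot90 :: "point \<Rightarrow> point" where
  "rot90 P = vector [- P $ 2, P $ 1]"

lemma rot90_nth [simp]: "rot90 P $ 1 = - P $ 2" "rot90 P $ 2 = P $ 1"
  by (simp_all add: rot90_def)

lemma inner_point: "x \<bullet> y = x $ 1 * y $ 1 + x $ 2 * y $ 2" for x y :: point
  by (simp add: inner_vec_def sum_2)

lemma point_eq_iff: "x = y \<longleftrightarrow> x $ 1 = y $ 1 \<and> x $ 2 = y $ 2" for x y :: point
  by (simp add: vec_eq_iff forall_2)

lemma rot90_diff: "rot90 (x - y) = rot90 x - rot90 y"
  by (simp add: point_eq_iff)

lemma rot90_scaleR: "rot90 (s *\<^sub>R x) = s *\<^sub>R rot90 x"
  by (simp add: point_eq_iff)

lemma rot90_rot90: "rot90 (rot90 x) = - x"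
  by (simp add: point_eq_iff)

lemma inner_rot90_self: "x \<bullet> rot90 x = 0"
  by (simp add: inner_point)

lemma inner_rot90_rot90: "rot90 x \<bullet> rot90 y = x \<bullet> y"
  by (simp add: inner_point)

lemma orthogonal_imp_scaleR_rot90:
  fixes x d :: point
  assumes "x \<bullet> d = 0" "d \<noteq> 0"
  obtains s where "x = s *\<^sub>R rot90 d"
proof -
  have dd: "d \<bullet> d \<noteq> 0" using assms(2) by simp
  have "(d \<bullet> d) *\<^sub>R x = (x \<bullet> rot90 d) *\<^sub>R rot90 d"
    using assms(1) by (simp add: point_eq_iff inner_point) algebra
  then have "x = ((x \<bullet> rot90 d) / (d \<bullet> d)) *\<^sub>R rot90 d"
    using dd by (simp add: point_eq_iff field_simps)
  then show thesis by (rule that)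
qed

lemma collinear_if_orthogonal:
  fixes P Q R d :: point
  assumes "(P - Q) \<bullet> d = 0" "(R - Q) \<bullet> d = 0" "d \<noteq> 0"
  shows "collinear {P, Q, R}"
  unfolding collinear_def
proof (intro exI[of _ "rot90 d"] ballI)
  fix x y assume xy: "x \<in> {P, Q, R}" "y \<in> {P, Q, R}"
  have "(z - Q) \<bullet> d = 0" if "z \<in> {P, Q, R}" for z
    using that assms by auto
  from this[OF xy(1)] this[OF xy(2)] have "(x - y) \<bullet> d = 0"
    by (simp add: inner_diff_left)
  then obtain s where "x - y = s *\<^sub>R rot90 d"
    using orthogonal_imp_scaleR_rot90 assms(3) by blast
  then show "\<exists>c. x - y = c *\<^sub>R rot90 d" ..
qed

section \<open>Circles as loci of a constant inscribed angle\<close>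

text \<open>With \<open>p = P - J\<close> and \<open>a = A - J\<close>, the number \<open>p \<bullet> rot90 a\<close> is the signed area of the
  parallelogram on \<open>P - J\<close> and \<open>P - A\<close>. So the equation says that \<open>k\<close> is, up to orientation, the
  cotangent of the angle at \<open>P\<close> in the triangle \<open>JPA\<close>. Clearing the denominator includes the
  points \<open>J\<close> and \<open>A\<close> themselves.\<close>

definition inscribed_circle :: "real \<Rightarrow> point \<Rightarrow> point \<Rightarrow> point set" where
  "inscribed_circle k J A = {P. (P - J) \<bullet> (P - A) = k * ((P - J) \<bullet> rot90 (A - J))}"

text \<open>Both sides are families of circles through \<open>J\<close> and \<open>A\<close> with centres on a line: the vector
  from \<open>J\<close> to the antipode \<open>J + 2 (c - J)\<close> projects to \<open>A - J\<close> on the chord, and \<open>k\<close> measures what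
  remains perpendicular to the chord.\<close>

lemma sphere_eq_inscribed_circle:
  assumes "J \<in> sphere c r" "A \<in> sphere c r" "A \<noteq> J"
  obtains k where "sphere c r = inscribed_circle k J A"
proof -
  have eqn: "P \<in> sphere c r \<longleftrightarrow> (P - J) \<bullet> (P - J) = 2 * ((P - J) \<bullet> (c - J))" for P
  proof -
    have "P \<in> sphere c r \<longleftrightarrow> dist c P = dist c J" using assms(1) by simp
    also have "\<dots> \<longleftrightarrow> (c - P) \<bullet> (c - P) = (c - J) \<bullet> (c - J)"
      by (simp add: dist_norm norm_eq)
    also have "\<dots> \<longleftrightarrow> (P - J) \<bullet> (P - J) = 2 * ((P - J) \<bullet> (c - J))"
      by (simp add: inner_diff inner_commute algebra_simps)
    finally show ?thesis .
  qed
  have "(A - J) \<bullet> (2 *\<^sub>R (c - J) - (A - J)) = 0"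
    using assms(2)[unfolded eqn] by (simp only: inner_diff_right[of _ "2 *\<^sub>R _"] inner_scaleR_right)
  then have "(2 *\<^sub>R (c - J) - (A - J)) \<bullet> (A - J) = 0"
    by (simp only: inner_commute)
  then obtain k where k: "2 *\<^sub>R (c - J) - (A - J) = k *\<^sub>R rot90 (A - J)"
    using orthogonal_imp_scaleR_rot90 assms(3) by (metis right_minus_eq)
  have "P \<in> sphere c r \<longleftrightarrow> P \<in> inscribed_circle k J A" for P
  proof -
    have "2 * ((P - J) \<bullet> (c - J)) = (P - J) \<bullet> (A - J) + k * ((P - J) \<bullet> rot90 (A - J))"
      using arg_cong[OF k, of "\<lambda>v. (P - J) \<bullet> v"]
      by (simp only: inner_diff_right[of _ "2 *\<^sub>R _"] inner_scaleR_right)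
    moreover have "(P - J) \<bullet> (P - A) = (P - J) \<bullet> (P - J) - (P - J) \<bullet> (A - J)"
      by (simp flip: inner_diff_right)
    ultimately show ?thesis
      unfolding eqn inscribed_circle_def mem_Collect_eq by linarith
  qed
  then show thesis using that by blast
qed

text \<open>The line \<open>JX\<close> meets the line \<open>XH\<close>, whose direction is \<open>rot90 d\<close>, under the angle that \<open>k\<close>
  encodes. Giving the line by its normal \<open>d\<close> instead of the point pair \<open>X, H\<close> makes the
  statement meaningful in the tangent case \<open>X = H\<close> too, where it is the equality of the
  inscribed and the tangent-chord angle.\<close>

lemma second_intersection_line_circle:
  assumes "d \<noteq> 0" "(H - A) \<bullet> d = 0"
    and "second_intersection H {P. (P - A) \<bullet> d = 0} (inscribed_circle k J H) X"
  shows "(X - J) \<bullet> rot90 d = k * ((X - J) \<bullet> d)"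
proof -
  have meet: "{P. (P - A) \<bullet> d = 0} \<inter> inscribed_circle k J H = {H, X}"
    using assms(3) by (simp add: second_intersection_def)
  have dd: "d \<bullet> d \<noteq> 0" using assms(1) by simp
  define h where "h = H - J"
  have crit: "H + t *\<^sub>R rot90 d \<in> inscribed_circle k J H \<longleftrightarrow>
      t = 0 \<or> h \<bullet> rot90 d + t * (d \<bullet> d) = k * (h \<bullet> d)" for t
  proof -
    have *: "H + t *\<^sub>R rot90 d - J = h + t *\<^sub>R rot90 d" by (simp add: h_def)
    have "H + t *\<^sub>R rot90 d \<in> inscribed_circle k J H \<longleftrightarrow>
        (h + t *\<^sub>R rot90 d) \<bullet> (t *\<^sub>R rot90 d) = k * ((h + t *\<^sub>R rot90 d) \<bullet> rot90 h)"
      by (simp add: inscribed_circle_def * flip: h_def)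
    also have "\<dots> \<longleftrightarrow> t * (h \<bullet> rot90 d + t * (d \<bullet> d)) = t * (k * (h \<bullet> d))"
      by (simp add: inner_add_left inner_rot90_rot90 inner_rot90_self inner_commute algebra_simps)
    finally show ?thesis by auto
  qed
  have "(X - H) \<bullet> d = 0"
  proof -
    have "(X - A) \<bullet> d = 0" using meet by blast
    then show ?thesis using assms(2) by (simp add: inner_diff_left)
  qed
  then obtain s where s: "X - H = s *\<^sub>R rot90 d"
    using orthogonal_imp_scaleR_rot90 assms(1) by blast
  then have X: "X = H + s *\<^sub>R rot90 d" by (simp add: algebra_simps)
  \<comment> \<open>The root of the linear factor in \<open>crit\<close> is a common point, hence \<open>H\<close> or \<open>X\<close>. If it is \<open>0\<close>
    while \<open>X \<noteq> H\<close>, then \<open>s\<close> is a nonzero solution of \<open>crit\<close>, so it is that root after all.\<close>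
  define t where "t = (k * (h \<bullet> d) - h \<bullet> rot90 d) / (d \<bullet> d)"
  have t: "h \<bullet> rot90 d + t * (d \<bullet> d) = k * (h \<bullet> d)" using dd by (simp add: t_def)
  have line: "(H + t *\<^sub>R rot90 d - A) \<bullet> d = 0"
    using assms(2) inner_rot90_self[of d]
    by (simp add: inner_add_left inner_diff_left inner_commute[of "rot90 d"])
  have "H + t *\<^sub>R rot90 d \<in> {H, X}"
    using line crit t meet by blast
  then have "t = 0 \<or> t = s"
    using X dd by (auto simp: point_eq_iff)
  moreover have "s = 0 \<or> h \<bullet> rot90 d + s * (d \<bullet> d) = k * (h \<bullet> d)"
    using crit[of s] meet X by blast
  ultimately have "h \<bullet> rot90 d + s * (d \<bullet> d) = k * (h \<bullet> d)"
    using t by auto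
  moreover have "X - J = h + s *\<^sub>R rot90 d" by (simp add: X h_def)
  moreover have "rot90 d \<bullet> d = 0" using inner_rot90_self[of d] by (simp add: inner_commute)
  ultimately show ?thesis
    by (simp add: inner_add_left inner_rot90_rot90)
qed

text \<open>A converse: the angle between \<open>JX\<close> and the line \<open>XA\<close> determines the parameter of the
  circle \<open>AJX\<close>. Together with the preceding lemma it carries the parameter of one circle
  through \<open>J\<close> and \<open>X\<close> over to the other, as \<open>A\<close>, \<open>X\<close> and \<open>H\<close> lie on a line.\<close>

lemma circle_eq_inscribed_circle:
  assumes K: "circle_through K A J X" and noncol: "\<not> collinear {A, J, X}"
    and d: "d \<noteq> 0" and line: "(X - A) \<bullet> d = 0"
    and angle: "(X - J) \<bullet> rot90 d = k * ((X - J) \<bullet> d)"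
  shows "K = inscribed_circle k J A"
proof -
  have AJ: "A \<noteq> J" and AX: "X \<noteq> A" using noncol by (auto simp: insert_commute)
  obtain m where m: "K = inscribed_circle m J A"
    using K sphere_eq_inscribed_circle AJ unfolding circle_through_def by metis
  obtain s where s: "X - A = s *\<^sub>R rot90 d"
    using orthogonal_imp_scaleR_rot90 line d by blast
  have "s \<noteq> 0" using s AX by auto
  define x where "x = X - J"
  have AJx: "A - J = x - s *\<^sub>R rot90 d" using s by (simp add: x_def algebra_simps)
  have "X \<in> inscribed_circle m J A" using K m by (simp add: circle_through_def)
  then have "s * (x \<bullet> rot90 d) = s * (m * (x \<bullet> d))"
    by (simp add: inscribed_circle_def s AJx rot90_diff rot90_scaleR rot90_rot90
        inner_rot90_self inner_add_right flip: x_def)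
  then have "k * (x \<bullet> d) = m * (x \<bullet> d)"
    using \<open>s \<noteq> 0\<close> angle by (simp add: x_def)
  moreover have "x \<bullet> d \<noteq> 0"
  proof
    assume "x \<bullet> d = 0"
    moreover have "(A - J) \<bullet> d = (X - J) \<bullet> d"
      using line by (simp add: inner_diff_left)
    ultimately have "collinear {A, J, X}"
      using collinear_if_orthogonal[of A J d X] d by (simp add: x_def)
    with noncol show False ..
  qed
  ultimately show ?thesis using m by simp
qed

text \<open>The point \<open>P\<close> of \<open>BC\<close> where \<open>JP\<close> makes the angle \<open>k\<close> with \<open>BC\<close> lies on both circles, since the
  lines \<open>PB\<close> and \<open>PC\<close> are the same line \<open>BC\<close>. That \<open>P \<noteq> J\<close> then forces \<open>P = L\<close>, which also
  shows that the circles cannot be tangent at \<open>J\<close>.\<close>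

lemma second_intersection_inscribed_circles:
  assumes BC: "B \<noteq> C" and J: "J \<notin> affine hull {B, C}"
    and L: "second_intersection J (inscribed_circle k J B) (inscribed_circle k J C) L"
  shows "L \<in> affine hull {B, C}"
proof -
  define d where "d = C - B"
  have dd: "d \<bullet> d \<noteq> 0" using BC by (simp add: d_def)
  \<comment> \<open>The value of \<open>s\<close> solves the linear equation \<open>angle\<close> below for \<open>P = B + s d\<close>.\<close>
  define s where "s = (- k * ((B - J) \<bullet> rot90 d) - (B - J) \<bullet> d) / (d \<bullet> d)"
  define P where "P = B + s *\<^sub>R d"
  have "P = (1 - s) *\<^sub>R B + s *\<^sub>R C" by (simp add: P_def d_def algebra_simps)
  then have P: "P \<in> affine hull {B, C}" unfolding affine_hull_2 by force
  define p where "p = P - J"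
  have pB: "p = (B - J) + s *\<^sub>R d" by (simp add: p_def P_def)
  have angle: "p \<bullet> d = - k * (p \<bullet> rot90 d)"
  proof -
    have "s * (d \<bullet> d) = - k * ((B - J) \<bullet> rot90 d) - (B - J) \<bullet> d"
      using dd by (simp add: s_def)
    then show ?thesis unfolding pB by (simp add: inner_add_left inner_rot90_self)
  qed
  have mem: "P \<in> inscribed_circle k J E" if "P - E = t *\<^sub>R d" for t E
  proof -
    have "E - J = p - t *\<^sub>R d" using that by (simp add: p_def algebra_simps)
    then have "p \<bullet> rot90 (E - J) = - t * (p \<bullet> rot90 d)"
      by (simp add: rot90_diff rot90_scaleR inner_diff_right inner_rot90_self)
    moreover have "p \<bullet> (P - E) = - k * t * (p \<bullet> rot90 d)"
      using angle by (simp add: that)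
    ultimately show ?thesis by (simp add: inscribed_circle_def flip: p_def)
  qed
  have "P - B = s *\<^sub>R d" "P - C = (s - 1) *\<^sub>R d"
    by (simp_all add: P_def d_def algebra_simps)
  then have "P \<in> {J, L}"
    using mem L unfolding second_intersection_def by blast
  then show ?thesis using P J by auto
qed

section \<open>Circumcircle and orthocentre\<close>

lemma inner_self_eq_if_sphere:
  fixes P P' c :: "'a :: real_inner"
  assumes "P \<in> sphere c r" "P' \<in> sphere c r"
  shows "(P - c) \<bullet> (P - c) = (P' - c) \<bullet> (P' - c)"
  using assms by (simp add: dist_norm norm_minus_commute flip: norm_eq)

lemma sphere_inter_line:
  fixes B C J :: "'a :: real_inner"
  assumes "B \<in> sphere c r" "C \<in> sphere c r" "J \<in> sphere c r" "J \<in> affine hull {B, C}"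
  shows "J = B \<or> J = C"
proof -
  obtain u v where uv: "J = u *\<^sub>R B + v *\<^sub>R C" "u + v = 1"
    using assms(4) unfolding affine_hull_2 by blast
  define b where "b = B - c"
  define d where "d = C - B"
  have u: "u = 1 - v" using uv(2) by simp
  have J: "J - c = b + v *\<^sub>R d" unfolding uv(1) u by (simp add: b_def d_def algebra_simps)
  have C: "C - c = b + d" by (simp add: b_def d_def)
  have "v * (2 * (b \<bullet> d) + v * (d \<bullet> d)) = 0"
    using inner_self_eq_if_sphere[OF assms(3,1)] unfolding J b_def[symmetric]
    by (simp add: inner_add_left inner_add_right inner_commute algebra_simps)
  moreover have "2 * (b \<bullet> d) = - (d \<bullet> d)"
    using inner_self_eq_if_sphere[OF assms(2,1)] unfolding C b_def[symmetric]
    by (simp add: inner_add_left inner_add_right inner_commute algebra_simps)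
  ultimately have "v * ((v - 1) * (d \<bullet> d)) = 0" by (simp add: algebra_simps)
  then have "v = 0 \<or> v = 1 \<or> d = 0" by simp
  then show ?thesis using uv by (auto simp: d_def u)
qed

text \<open>Relative to the circumcentre the sum \<open>a + b + g\<close> of the vertices lies on every altitude,
  because \<open>(b + g) \<bullet> (g - b) = 0\<close> for vectors of equal length. So the difference of \<open>H\<close> and
  this sum is orthogonal to two sides, which are not parallel.\<close>

lemma orthocentre_eq_sum:
  fixes A B C H c :: point
  assumes tri: "\<not> collinear {A, B, C}"
    and H: "orthocentre H A B C"
    and on: "A \<in> sphere c r" "B \<in> sphere c r" "C \<in> sphere c r"
  shows "H - c = (A - c) + (B - c) + (C - c)"
proof (rule ccontr)
  define a b g h where "a = A - c" and "b = B - c" and "g = C - c" and "h = H - c"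
  define v where "v = h - a - b - g"
  assume "\<not> ?thesis"
  then have v: "v \<noteq> 0" by (simp add: v_def a_def b_def g_def h_def algebra_simps)
  have ab: "a \<bullet> a = b \<bullet> b" and bg: "b \<bullet> b = g \<bullet> g"
    using inner_self_eq_if_sphere[OF on(1,2)] inner_self_eq_if_sphere[OF on(2,3)]
    by (simp_all only: a_def b_def g_def)
  have "(h - a) \<bullet> (g - b) = 0" "(h - g) \<bullet> (b - a) = 0"
    using H by (simp_all add: orthocentre_def altitude_def a_def b_def g_def h_def)
  then have "(g - b) \<bullet> v = 0" "(a - b) \<bullet> v = 0"
    using ab bg by (simp_all add: v_def inner_diff_left inner_diff_right inner_commute)
  then have "collinear {A, B, C}"
    using collinear_if_orthogonal[of A B v C] v by (simp add: a_def b_def g_def)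
  with tri show False ..
qed

lemma pairwise_orthogonal_imp_zero:
  fixes x y z :: point
  assumes "x \<bullet> y = 0" "x \<bullet> z = 0" "y \<bullet> z = 0"
  shows "x = 0 \<or> y = 0 \<or> z = 0"
proof (cases "x = 0")
  case False
  have "y \<bullet> x = 0" "z \<bullet> x = 0" using assms by (simp_all add: inner_commute)
  then obtain s t where "y = s *\<^sub>R rot90 x" "z = t *\<^sub>R rot90 x"
    using orthogonal_imp_scaleR_rot90 False by metis
  then show ?thesis using assms(3) False by (auto simp: inner_rot90_rot90)
qed simp

text \<open>Relative to the circumcentre, \<open>\<bar>a + b + g\<bar> = \<bar>a\<bar>\<close> means that the three sums of two
  vertices are pairwise orthogonal. The plane has no room for three such nonzero vectors, so
  two vertices are antipodal and \<open>H\<close> is the third.\<close>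

lemma orthocentre_on_circumcircle:
  assumes tri: "\<not> collinear {A, B, C}"
    and H: "orthocentre H A B C"
    and K: "circle_through K A B C" and HK: "H \<in> K"
  shows "H = A \<or> H = B \<or> H = C"
proof -
  obtain c r where on: "A \<in> sphere c r" "B \<in> sphere c r" "C \<in> sphere c r" "H \<in> sphere c r"
    using K HK unfolding circle_through_def by blast
  define a b g where "a = A - c" and "b = B - c" and "g = C - c"
  have h: "H - c = a + b + g"
    using orthocentre_eq_sum[OF tri H on(1-3)] by (simp add: a_def b_def g_def)
  have eqs: "b \<bullet> b = a \<bullet> a" "g \<bullet> g = a \<bullet> a" "(a + b + g) \<bullet> (a + b + g) = a \<bullet> a"
    using inner_self_eq_if_sphere[OF on(2,1)] inner_self_eq_if_sphere[OF on(3,1)]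
      inner_self_eq_if_sphere[OF on(4,1)]
    by (simp_all only: h flip: a_def b_def g_def)
  have "(a + b) \<bullet> (a + g) = 0" "(a + b) \<bullet> (b + g) = 0" "(a + g) \<bullet> (b + g) = 0"
    using eqs by (simp_all add: inner_add_left inner_add_right inner_commute)
  then have "a + b = 0 \<or> a + g = 0 \<or> b + g = 0"
    by (rule pairwise_orthogonal_imp_zero)
  then have "H - c = g \<or> H - c = b \<or> H - c = a"
    using h by (auto simp: algebra_simps)
  then show ?thesis by (auto simp: a_def b_def g_def)
qed

section \<open>The second intersections lie on the sides\<close>

theorem theorem4p1:
  fixes A B C H J Q X Y Z L M N :: point
    and \<Sigma> S KA KB KC :: "point set"
  assumes triangle: "\<not> collinear {A, B, C}"
    and circumcircle: "circle_through \<Sigma> A B C"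
    and orthocentre: "orthocentre H A B C"
    and J: "J \<in> \<Sigma>" "J \<noteq> A" "J \<noteq> B" "J \<noteq> C"
    and Q: "Q \<in> perp_bisector J H"
    and S: "S = sphere Q (dist Q J)"
    and X: "second_intersection H (altitude A B C) S X"
    and Y: "second_intersection H (altitude B C A) S Y"
    and Z: "second_intersection H (altitude C A B) S Z"
    and AJX: "distinct [A, J, X]" "\<not> collinear {A, J, X}"
    and BJY: "distinct [B, J, Y]" "\<not> collinear {B, J, Y}"
    and CJZ: "distinct [C, J, Z]" "\<not> collinear {C, J, Z}"
    and KA: "circle_through KA A J X"
    and KB: "circle_through KB B J Y"
    and KC: "circle_through KC C J Z"
    and L: "second_intersection J KB KC L"
    and M: "second_intersection J KC KA M"
    and N: "second_intersection J KA KB N"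
  shows "L \<in> affine hull {B, C} \<and> M \<in> affine hull {C, A} \<and> N \<in> affine hull {A, B}"
proof -
  obtain c r where \<Sigma>: "\<Sigma> = sphere c r" and on: "A \<in> \<Sigma>" "B \<in> \<Sigma>" "C \<in> \<Sigma>"
    using circumcircle unfolding circle_through_def by blast
  have dist: "A \<noteq> B" "B \<noteq> C" "C \<noteq> A" using triangle by (auto simp: insert_commute)
  have "J \<noteq> H"
    using orthocentre_on_circumcircle[OF triangle orthocentre circumcircle] J by blast
  have "H \<in> S"
  proof -
    have "(Q - midpoint J H) \<bullet> (H - J) = 0" using Q by (simp add: perp_bisector_def)
    then have "dist Q H = dist Q J"
      by (simp add: midpoint_def dist_norm norm_eq inner_diff inner_add inner_commute algebra_simps)
    then show ?thesis using S by simp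
  qed
  then obtain k where k: "S = inscribed_circle k J H"
    using sphere_eq_inscribed_circle[of J Q "dist Q J" H] S \<open>J \<noteq> H\<close> by auto
  \<comment> \<open>The three circles are treated alike: \<open>D\<close> is a vertex, \<open>EF\<close> the opposite side, \<open>W\<close> the second
    intersection of the altitude through \<open>D\<close> with \<open>S\<close>.\<close>
  have side: "K = inscribed_circle k J D"
    if "circle_through K D J W" "\<not> collinear {D, J, W}" "E \<noteq> F"
      "H \<in> altitude D E F" "second_intersection H (altitude D E F) S W"
    for K D W E F
  proof (rule circle_eq_inscribed_circle[OF that(1,2)])
    show "F - E \<noteq> 0" using that(3) by simp
    show "(W - D) \<bullet> (F - E) = 0"
      using that(5) unfolding second_intersection_def altitude_def by blast
    show "(W - J) \<bullet> rot90 (F - E) = k * ((W - J) \<bullet> (F - E))"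
      using second_intersection_line_circle[of "F - E" H D k J W] that
      unfolding altitude_def k by simp
  qed
  have H: "H \<in> altitude A B C" "H \<in> altitude B C A" "H \<in> altitude C A B"
    using orthocentre by (simp_all add: orthocentre_def)
  have K: "KA = inscribed_circle k J A" "KB = inscribed_circle k J B"
    "KC = inscribed_circle k J C"
    using side[OF KA AJX(2) dist(2) H(1) X] side[OF KB BJY(2) dist(3) H(2) Y]
      side[OF KC CJZ(2) dist(1) H(3) Z] by blast+
  have J_off: "J \<notin> affine hull {B, C}" "J \<notin> affine hull {C, A}" "J \<notin> affine hull {A, B}"
    using sphere_inter_line[of B c r C J] sphere_inter_line[of C c r A J]
      sphere_inter_line[of A c r B J] J on \<Sigma> by blast+
  show ?thesis
    using second_intersection_inscribed_circles[OF dist(2) J_off(1) L[unfolded K]]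
      second_intersection_inscribed_circles[OF dist(3) J_off(2) M[unfolded K]]
      second_intersection_inscribed_circles[OF dist(1) J_off(3) N[unfolded K]]
    by blast
qed

end
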